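(* Let $0<c_0<c_1$, $K_{0,1}=[c_0,c_1]^n\subset\mathbb{R}^n$, let $\Phi:\mathbb{R}^n\to\mathbb{R}^m$ be a differentiable map with Jacobian $J_\Phi$, let $\Lambda^\delta\in\mathbb{R}^m$, and let $\lambda,\rho,\mu>0$. Let $g$ be any (proper) non-negative, coercive, continuous and convex functional on $\mathbb{R}^n$ with values in $[0,\infty]$, whose domain is contained in $K_{0,1}$, and set $$\mathcal{J}_\lambda^\delta(\sigma)=f(\sigma)+\lambda g(\sigma),\qquad f(\sigma)=\tfrac12\|\Phi(\sigma)-\Lambda^\delta\|^2+\tfrac{\lambda\rho}{2}\|\sigma\|^2 .$$ Assume that $\Phi$ satisfies: 1. (Restricted Isometry Property) there exist $0<\alpha\le\beta$ such that $\alpha\|\sigma_1-\sigma_2\|^2\le\|J_\Phi(\sigma)(\sigma_1-\sigma_2)\|^2\le\beta\|\sigma_1-\sigma_2\|^2$ for all $\sigma\in K_{0,1}$ and all $\sigma_1,\sigma_2\in\mathbb{R}^n$; 2. (Mild nonlinearity) there exists $\gamma>0$ such that $\|\Phi(\sigma_1)-\Phi(\sigma_2)-J_\Phi(\sigma_2)(\sigma_1-\sigma_2)\|^2\le\gamma\|\sigma_1-\sigma_2\|^2$ for all $\sigma_1,\sigma_2\in K_{0,1}$. Require moreover that $$\mu\le\frac{1}{2\beta},\qquad \mu\le\frac{1}{2\lambda\rho},\qquad 0<\alpha+\lambda\rho-2\gamma.$$ Then the sequence $(\sigma^{(k)})$ defined by the proximal-gradient iteration $$\sigma^{(k+1)}=\operatorname{prox}_{\mu\lambda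 g}\big(\sigma^{(k)}-\mu\lambda\rho\,\sigma^{(k)}+\mu J_\Phi(\sigma^{(k)})^T(\Lambda^\delta-\Phi(\sigma^{(k)}))\big)$$ converges to a cluster point $\overline{\sigma}$ such that, for any $\sigma\in\operatorname{dom}(g)$, $$\|\sigma-\overline{\sigma}\|^2\le\frac{4}{\alpha+\lambda\rho-2\gamma}\,\mathcal{J}_\lambda^\delta(\sigma).$$
   Context: $\|\cdot\|$ is the Euclidean norm, $\operatorname{dom}(g)=\{\sigma: g(\sigma)<\infty\}$, and $\operatorname{prox}_{h}(x)=\arg\min_{y\in\mathbb{R}^n}\{\frac12\|y-x\|^2+h(y)\}$. $J_\Phi(\sigma)\in\mathbb{R}^{m\times n}$ is the Jacobian matrix of $\Phi$ at $\sigma$. The model case is $g=R+\chi_K$ with $R$ convex and continuous and $\chi_K$ equal to $0$ on a compact convex set $K\subset K_{0,1}$ and $+\infty$ elsewhere, so continuity of $g$ is understood on its domain.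
   Formalization: Convergence of the whole sequence can fail under these hypotheses (iterates may alternate between two points); what is proved is that a cluster point exists, so a subsequence converges, and that every cluster point satisfies the estimate for all σ in dom(g). *)

theory Defs
  imports "HOL-Analysis.Analysis"
begin

definition edom :: "('a \<Rightarrow> ereal) \<Rightarrow> 'a set" where
  "edom g = {x. g x < \<infinity>}"

text \<open>
  Convexity for extended real-valued functions (the library's \<^const>\<open>convex_on\<close> is for
  real-valued ones). It is only used for functions bounded below by 0, so that no
  \<open>\<infinity> - \<infinity>\<close> occurs; at the end points, \<open>0 * \<infinity> = 0\<close> makes the inequality trivial.
\<close>

definition econvex :: "('a::real_vector \<Rightarrow> ereal) \<Rightarrow> bool" where
  "econvex g \<longleftrightarrow> (\<forall>x y. \<forall>t\<in>{0..1::real}.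
     g ((1 - t) *\<^sub>R x + t *\<^sub>R y) \<le> ereal (1 - t) * g x + ereal t * g y)"

definition coercive :: "('a::real_normed_vector \<Rightarrow> ereal) \<Rightarrow> bool" where
  "coercive g \<longleftrightarrow> (g \<longlongrightarrow> \<infinity>) at_infinity"

text \<open>
  The argmin is a set. For proper convex \<open>h\<close> it has at most one element, and exactly one if
  in addition \<open>h\<close> is continuous on a compact domain (lemma \<open>prox_ex1\<close> below). A function that
  is merely continuous on its domain need not attain the minimum if its domain is not closed;
  \<open>prox h x\<close> is then empty rather than an arbitrary point.
\<close>

definition prox :: "('a::real_normed_vector \<Rightarrow> ereal) \<Rightarrow> 'a \<Rightarrow> 'a set" where
  "prox h x = {p. is_arg_min (\<lambda>y. ereal (1/2 * (norm (y - x))\<^sup>2) + h y) (\<lambda>_. True) p}"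

abbreviation Jac :: "(real^'n \<Rightarrow> real^'m) \<Rightarrow> real^'n \<Rightarrow> real^'n^'m" where
  "Jac \<Phi> x \<equiv> jacobian \<Phi> (at x)"

definition smooth_part ::
    "(real^'n \<Rightarrow> real^'m) \<Rightarrow> real^'m \<Rightarrow> real \<Rightarrow> real \<Rightarrow> real^'n \<Rightarrow> real" where
  "smooth_part \<Phi> \<Lambda> lam rho x = 1/2 * (norm (\<Phi> x - \<Lambda>))\<^sup>2 + lam * rho / 2 * (norm x)\<^sup>2"

definition objective ::
    "(real^'n \<Rightarrow> real^'m) \<Rightarrow> real^'m \<Rightarrow> real \<Rightarrow> real \<Rightarrow> (real^'n \<Rightarrow> ereal) \<Rightarrow> real^'n \<Rightarrow> ereal" where
  "objective \<Phi> \<Lambda> lam rho g x = ereal (smooth_part \<Phi> \<Lambda> lam rho x) + ereal lam * g x"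

text \<open>
  The iterates stay in a compact set, but the whole sequence need not converge: for
  \<open>\<Phi> x = x - (x - 1)\<^sup>2 / 10\<close>, \<open>\<Lambda> = 21\<close>, \<open>lam = rho = 1\<close>, \<open>\<mu> = 1/2\<close> and \<open>g x = 16 * x\<close> on \<open>[1, 2]\<close>
  (\<open>\<infinity>\<close> elsewhere), with \<open>\<alpha> = 16/25\<close>, \<open>\<beta> = 1\<close>, \<open>\<gamma> = 1/100\<close>, the iteration started in 1 is
  1, 2, 1, 2, \<open>\<dots>\<close>. Convergence to a cluster point is therefore convergence along a subsequence.
\<close>

definition cluster_point :: "(nat \<Rightarrow> 'a::topological_space) \<Rightarrow> 'a \<Rightarrow> bool" where
  "cluster_point s l \<longleftrightarrow> (\<exists>r :: nat \<Rightarrow> nat. strict_mono r \<and> (s \<circ> r) \<longlonglongrightarrow> l)"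

lemma prox_unique:
  fixes h :: "'a::real_inner \<Rightarrow> ereal"
  assumes nonneg: "\<And>x. 0 \<le> h x" and proper: "edom h \<noteq> {}" and conv: "econvex h"
    and p: "p \<in> prox h z" and q: "q \<in> prox h z"
  shows "p = q"
proof (rule ccontr)
  assume "p \<noteq> q"
  define F where "F = (\<lambda>y. ereal (1/2 * (norm (y - z))\<^sup>2) + h y)"
  have min: "F p \<le> F y" "F q \<le> F y" for y
    using p q by (auto simp: prox_def is_arg_min_def F_def not_less)
  obtain x0 where x0: "h x0 < \<infinity>" using proper by (auto simp: edom_def)
  have "F x0 < \<infinity>" using x0 by (simp add: F_def)
  then have fin: "F p < \<infinity>" "F q < \<infinity>" using min by (metis le_less_trans)+
  obtain a b where a: "h p = ereal a" and b: "h q = ereal b"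
    using fin nonneg[of p] nonneg[of q] unfolding F_def
    by (cases "h p"; cases "h q") auto
  define w where "w = (1 - 1/2) *\<^sub>R p + (1/2::real) *\<^sub>R q"
  have "h w \<le> ereal (1 - 1/2) * h p + ereal (1/2) * h q"
    using conv unfolding econvex_def w_def by (metis atLeastAtMost_iff half_gt_zero_iff less_eq_real_def
        zero_less_one field_sum_of_halves le_add_same_cancel1)
  then have hw: "h w \<le> ereal (a/2 + b/2)" by (simp add: a b)
  have par: "(norm (w - z))\<^sup>2 = (norm (p - z))\<^sup>2/2 + (norm (q - z))\<^sup>2/2 - (norm (p - q))\<^sup>2/4"
    unfolding w_def power2_norm_eq_inner
    by (simp add: inner_diff inner_add inner_commute field_simps)
  obtain c where c: "h w = ereal c" "c \<le> a/2 + b/2"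
    using hw nonneg[of w] by (cases "h w") auto
  have "(norm (p - q))\<^sup>2 > 0" using \<open>p \<noteq> q\<close> by simp
  moreover have "1/2 * (norm (p - z))\<^sup>2 + a \<le> 1/2 * (norm (w - z))\<^sup>2 + c"
    using min(1)[of w] by (simp add: F_def a c(1))
  moreover have "1/2 * (norm (q - z))\<^sup>2 + b \<le> 1/2 * (norm (w - z))\<^sup>2 + c"
    using min(2)[of w] by (simp add: F_def b c(1))
  ultimately show False using par c(2) by argo
qed

lemma prox_ex1:
  fixes h :: "'a::real_inner \<Rightarrow> ereal"
  assumes nonneg: "\<And>x. 0 \<le> h x" and proper: "edom h \<noteq> {}" and conv: "econvex h"
    and cont: "continuous_on (edom h) h" and comp: "compact (edom h)"
  shows "\<exists>!p. p \<in> prox h z"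
proof -
  define F where "F = (\<lambda>y. ereal (1/2 * (norm (y - z))\<^sup>2) + h y)"
  define G where "G = (\<lambda>y. 1/2 * (norm (y - z))\<^sup>2 + real_of_ereal (h y))"
  have fin: "\<bar>h x\<bar> \<noteq> \<infinity>" if "x \<in> edom h" for x
    using that nonneg[of x] by (auto simp: edom_def)
  have FG: "F x = ereal (G x)" if "x \<in> edom h" for x
    using fin[OF that] by (auto simp: F_def G_def plus_ereal.simps(1)[symmetric] ereal_real
        simp del: plus_ereal.simps(1))
  have "continuous_on (edom h) (\<lambda>x. real_of_ereal (h x))"
    unfolding continuous_on_def
  proof
    fix x assume x: "x \<in> edom h"
    have "(h \<longlongrightarrow> ereal (real_of_ereal (h x))) (at x within edom h)"
      using cont x fin[OF x] by (simp add: continuous_on_def ereal_real)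
    then show "((\<lambda>x. real_of_ereal (h x)) \<longlongrightarrow> real_of_ereal (h x)) (at x within edom h)"
      by (rule lim_real_of_ereal)
  qed
  then have "continuous_on (edom h) G" unfolding G_def by (intro continuous_intros)
  then obtain p where p: "p \<in> edom h" "\<And>y. y \<in> edom h \<Longrightarrow> G p \<le> G y"
    using continuous_attains_inf[OF comp proper] by blast
  have "F p \<le> F y" for y
  proof (cases "y \<in> edom h")
    case True
    then show ?thesis using p FG by simp
  next
    case False
    then show ?thesis by (simp add: edom_def F_def)
  qed
  then have "p \<in> prox h z" by (auto simp: prox_def is_arg_min_def F_def not_less)
  then show ?thesis using prox_unique[OF nonneg proper conv] by blast
qed

end

theory Submission
  imports Defs
begin

text \<open>
  The iteration is driven by the residual linearised at the current iterate. Write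
  \<open>\<kappa> = \<alpha> + \<lambda>\<rho> - 2\<gamma>\<close>, fix \<open>x \<in> dom g\<close>, and let \<open>J\<close> be the Jacobian at \<open>s k\<close>,
  where \<open>k \<ge> 1\<close> ensures \<open>s k \<in> K\<close>. One iteration is a proximal gradient step from \<open>s k\<close> for the convex quadratic
  \<open>q y = \<parallel>\<Phi> (s k) + J (y - s k) - \<Lambda>\<parallel>\<^sup>2 / 2 + \<lambda>\<rho> \<parallel>y\<parallel>\<^sup>2 / 2\<close>,
  because \<open>q\<close> and the smooth part of the objective have the same gradient at \<open>s k\<close>.

  The curvature of \<open>q\<close> is at least \<open>\<alpha> + \<lambda>\<rho>\<close>, and at most \<open>\<beta> + \<lambda>\<rho> \<le> 1/\<mu>\<close>. The upper bound makes the
  step admissible, so the usual estimate for a proximal gradient step compares \<open>s (k+1)\<close> with any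
  \<open>x\<close> (lemma \<open>prox_gradient_step_estimate\<close>, which rests on the three-point inequality
  \<open>prox_three_point\<close>). In it the values of \<open>q\<close> and \<open>g\<close> at \<open>s (k+1)\<close> are simply bounded below by 0.
  At \<open>x\<close>, mild nonlinearity replaces the linearised residual by the true one: by
  \<open>\<parallel>a + b\<parallel>\<^sup>2 \<le> 2\<parallel>a\<parallel>\<^sup>2 + 2\<parallel>b\<parallel>\<^sup>2\<close> this costs a factor 2 on the objective and the term \<open>2\<gamma>\<close> in \<open>\<kappa>\<close>. The
  result is
  \<open>\<parallel>x - s (k+1)\<parallel>\<^sup>2 \<le> (1 - \<mu>\<kappa>) \<parallel>x - s k\<parallel>\<^sup>2 + \<mu>\<kappa> C\<close> with \<open>C = (4/\<kappa>) \<J>(x)\<close>.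

  Since \<open>0 < \<mu>\<kappa> \<le> 1\<close>, the excess of \<open>\<parallel>x - s k\<parallel>\<^sup>2\<close> over \<open>C\<close> is bounded by a geometric null sequence, so every cluster
  point \<open>l\<close> satisfies \<open>\<parallel>x - l\<parallel>\<^sup>2 \<le> C\<close>; cluster points exist because the iterates stay in the compact
  cube \<open>K\<close>.
\<close>

lemma prox_in_edom:
  assumes "p \<in> prox h z" and "edom h \<noteq> {}"
  shows "p \<in> edom h"
proof -
  obtain x where x: "h x < \<infinity>" using assms(2) by (auto simp: edom_def)
  have "ereal (1/2 * (norm (p - z))\<^sup>2) + h p \<le> ereal (1/2 * (norm (x - z))\<^sup>2) + h x"
    using assms(1) by (auto simp: prox_def is_arg_min_def not_less)
  also have "\<dots> < \<infinity>" using x by simp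
  finally show ?thesis by (simp add: edom_def)
qed

text \<open>
  The function minimised by \<open>p\<close> is 1-strongly convex, hence exceeds its minimum at \<open>x\<close> by at least
  \<open>\<parallel>x - p\<parallel>\<^sup>2 / 2\<close>. The proof compares \<open>p\<close> with points of the segment towards \<open>x\<close> and lets them tend
  to \<open>p\<close>.
\<close>

lemma prox_three_point:
  fixes h :: "'a::real_inner \<Rightarrow> ereal"
  assumes nonneg: "\<And>y. 0 \<le> h y" and conv: "econvex h"
    and p: "p \<in> prox h z" and x: "h x = ereal b"
  obtains a where "h p = ereal a"
    and "1/2 * (norm (p - z))\<^sup>2 + a + 1/2 * (norm (x - p))\<^sup>2 \<le> 1/2 * (norm (x - z))\<^sup>2 + b"
proof -
  have "p \<in> edom h" using prox_in_edom[OF p] x by (force simp: edom_def)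
  then obtain a where a: "h p = ereal a"
    using nonneg[of p] by (cases "h p") (auto simp: edom_def)
  define D where "D = 1/2 * (norm (x - z))\<^sup>2 + b - (1/2 * (norm (p - z))\<^sup>2 + a)"
  have bound: "(1 - t) * (1/2 * (norm (x - p))\<^sup>2) \<le> D" if t: "0 < t" "t < 1" for t
  proof -
    define y where "y = (1 - t) *\<^sub>R p + t *\<^sub>R x"
    have "h y \<le> ereal (1 - t) * h p + ereal t * h x"
      using conv t by (simp add: econvex_def y_def)
    then obtain c where c: "h y = ereal c" "c \<le> (1 - t) * a + t * b"
      using nonneg[of y] by (cases "h y") (auto simp: a x)
    have "1/2 * (norm (p - z))\<^sup>2 + a \<le> 1/2 * (norm (y - z))\<^sup>2 + c"
    proof -
      have "ereal (1/2 * (norm (p - z))\<^sup>2) + h p \<le> ereal (1/2 * (norm (y - z))\<^sup>2) + h y"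
        using p by (auto simp: prox_def is_arg_min_def not_less)
      then show ?thesis by (simp add: a c(1))
    qed
    moreover have "(norm (y - z))\<^sup>2 =
        (1 - t) * (norm (p - z))\<^sup>2 + t * (norm (x - z))\<^sup>2 - t * (1 - t) * (norm (x - p))\<^sup>2"
      unfolding y_def power2_norm_eq_inner
      by (simp add: inner_diff inner_add inner_commute algebra_simps power2_eq_square)
    ultimately have "t * ((1 - t) * (1/2 * (norm (x - p))\<^sup>2)) \<le> t * D"
      using c(2) unfolding D_def by argo
    then show ?thesis using t(1) by simp
  qed
  have "((\<lambda>t::real. (1 - t) * (1/2 * (norm (x - p))\<^sup>2)) \<longlongrightarrow> (1 - 0) * (1/2 * (norm (x - p))\<^sup>2))
      (at_right 0)"
    by (intro tendsto_intros)
  moreover have "\<forall>\<^sub>F t in at_right (0::real). (1 - t) * (1/2 * (norm (x - p))\<^sup>2) \<le> D"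
    unfolding eventually_at_right_field using bound by (intro exI[of _ 1]) auto
  ultimately have "(1 - 0) * (1/2 * (norm (x - p))\<^sup>2) \<le> D"
    by (rule tendsto_upperbound) simp
  then have "1/2 * (norm (p - z))\<^sup>2 + a + 1/2 * (norm (x - p))\<^sup>2 \<le> 1/2 * (norm (x - z))\<^sup>2 + b"
    by (simp add: D_def)
  with a show thesis by (rule that)
qed

lemma norm_diff_power2_le:
  fixes a b :: "'a::real_inner"
  shows "(norm (a - b))\<^sup>2 \<le> 2 * (norm a)\<^sup>2 + 2 * (norm b)\<^sup>2"
  using inner_ge_zero[of "a + b"] unfolding power2_norm_eq_inner
  by (simp add: inner_diff inner_add inner_commute)

lemma econvex_cmult:
  assumes "econvex g" and "0 \<le> c" and nonneg: "\<And>x. 0 \<le> g x"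
  shows "econvex (\<lambda>x. ereal c * g x)"
  unfolding econvex_def
proof (intro allI ballI)
  fix x y and t :: real
  assume t: "t \<in> {0..1}"
  have "ereal c * g ((1 - t) *\<^sub>R x + t *\<^sub>R y) \<le> ereal c * (ereal (1 - t) * g x + ereal t * g y)"
    using assms t by (intro ereal_mult_left_mono) (auto simp: econvex_def)
  also have "\<dots> = ereal (1 - t) * (ereal c * g x) + ereal t * (ereal c * g y)"
    using t nonneg \<open>0 \<le> c\<close> by (subst ereal_right_distrib) (auto simp: ac_simps)
  finally show "ereal c * g ((1 - t) *\<^sub>R x + t *\<^sub>R y)
      \<le> ereal (1 - t) * (ereal c * g x) + ereal t * (ereal c * g y)" .
qed

text \<open>
  One proximal gradient step from \<open>s\<close>, with step size \<open>\<mu>\<close> and penalty \<open>h = \<mu> G\<close>, for the quadratic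
  \<open>q x = \<parallel>A (x - s) - y\<parallel>\<^sup>2 / 2 + \<tau> \<parallel>x\<parallel>\<^sup>2 / 2\<close>. The sufficient-decrease condition \<open>\<mu> (\<beta> + \<tau>) \<le> 1\<close> makes
  the sum of the terms in \<open>p - s\<close> nonnegative; this sum and the nonnegative \<open>q p\<close> and \<open>h p\<close> are then discarded.
\<close>

lemma prox_gradient_step_estimate:
  fixes A :: "real^'n^'m" and h :: "real^'n \<Rightarrow> ereal"
  assumes nonneg: "\<And>y. 0 \<le> h y" and conv: "econvex h"
    and p: "p \<in> prox h (s - (\<mu> * \<tau>) *\<^sub>R s + \<mu> *\<^sub>R (transpose A *v y))"
    and x: "h x = ereal b"
    and pos: "0 \<le> \<mu>" "0 \<le> \<tau>"
    and bound: "(norm (A *v (p - s)))\<^sup>2 \<le> \<beta> * (norm (p - s))\<^sup>2"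
    and step: "\<mu> * (\<beta> + \<tau>) \<le> 1"
  shows "(norm (x - p))\<^sup>2 \<le> (1 - \<mu> * \<tau>) * (norm (x - s))\<^sup>2 - \<mu> * (norm (A *v (x - s)))\<^sup>2
    + \<mu> * (norm (A *v (x - s) - y))\<^sup>2 + \<mu> * \<tau> * (norm x)\<^sup>2 + 2 * b"
proof -
  define w where "w = \<tau> *\<^sub>R s - transpose A *v y"
  have z: "s - (\<mu> * \<tau>) *\<^sub>R s + \<mu> *\<^sub>R (transpose A *v y) = s - \<mu> *\<^sub>R w"
    by (simp add: w_def algebra_simps)
  obtain a where a: "h p = ereal a"
    and three: "1/2 * (norm (p - (s - \<mu> *\<^sub>R w)))\<^sup>2 + a + 1/2 * (norm (x - p))\<^sup>2
      \<le> 1/2 * (norm (x - (s - \<mu> *\<^sub>R w)))\<^sup>2 + b"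
    using prox_three_point[OF nonneg conv p x] unfolding z by metis
  have "0 \<le> a" using nonneg[of p] a by simp
  have shift: "(norm (v - (s - \<mu> *\<^sub>R w)))\<^sup>2
      = (norm (v - s))\<^sup>2 + 2 * \<mu> * inner w (v - s) + \<mu>\<^sup>2 * (norm w)\<^sup>2" for v
    unfolding power2_norm_eq_inner
    by (simp add: inner_diff inner_add inner_commute algebra_simps power2_eq_square)
  \<comment> \<open>\<open>w\<close> is the gradient of \<open>q\<close> at \<open>s\<close>: this is the exact second-order expansion of \<open>q\<close> about \<open>s\<close>.\<close>
  have expand: "2 * inner w (v - s) = (norm (A *v (v - s) - y))\<^sup>2 - (norm y)\<^sup>2
      - (norm (A *v (v - s)))\<^sup>2 + \<tau> * ((norm v)\<^sup>2 - (norm s)\<^sup>2 - (norm (v - s))\<^sup>2)" for v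
  proof -
    have "inner (transpose A *v y) (v - s) = inner y (A *v (v - s))"
      by (metis dot_lmul_matrix matrix_transpose_mul transpose_matrix_vector)
    then have "inner w (v - s) = \<tau> * inner s (v - s) - inner y (A *v (v - s))"
      by (simp add: w_def inner_diff_left)
    then show ?thesis
      unfolding power2_norm_eq_inner
      by (simp add: inner_diff inner_commute algebra_simps)
  qed
  have "\<mu> * (norm (A *v (p - s)))\<^sup>2 \<le> \<mu> * (\<beta> * (norm (p - s))\<^sup>2)"
    using bound pos by (simp add: mult_left_mono)
  moreover have "\<mu> * (\<beta> + \<tau>) * (norm (p - s))\<^sup>2 \<le> 1 * (norm (p - s))\<^sup>2"
    using step by (intro mult_right_mono) auto
  ultimately have curv: "\<mu> * (norm (A *v (p - s)))\<^sup>2 + \<mu> * \<tau> * (norm (p - s))\<^sup>2 \<le> (norm (p - s))\<^sup>2"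
    by (simp add: algebra_simps)
  have drop: "0 \<le> \<mu> * (norm (A *v (p - s) - y))\<^sup>2" "0 \<le> \<mu> * \<tau> * (norm p)\<^sup>2"
    using pos by simp_all
  have ex: "2 * \<mu> * inner w (v - s) = \<mu> * (norm (A *v (v - s) - y))\<^sup>2 - \<mu> * (norm y)\<^sup>2
      - \<mu> * (norm (A *v (v - s)))\<^sup>2
      + (\<mu> * \<tau> * (norm v)\<^sup>2 - \<mu> * \<tau> * (norm s)\<^sup>2 - \<mu> * \<tau> * (norm (v - s))\<^sup>2)" for v
    using arg_cong[OF expand[of v], of "\<lambda>u. \<mu> * u"] by (simp add: algebra_simps)
  have "(1 - \<mu> * \<tau>) * (norm (x - s))\<^sup>2 = (norm (x - s))\<^sup>2 - \<mu> * \<tau> * (norm (x - s))\<^sup>2"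
    by (simp add: algebra_simps)
  then show ?thesis
    using three[unfolded shift ex] curv drop \<open>0 \<le> a\<close> by argo
qed

text \<open>
  The constant \<open>C\<close> is the fixed point of the affine recursion, and the excess over it contracts
  by the factor \<open>1 - t\<close>; the limit is taken along a subsequence because the full sequence \<open>a\<close> need
  not converge.
\<close>

lemma subseq_limit_le_of_affine_recursion:
  fixes a :: "nat \<Rightarrow> real"
  assumes rec: "\<And>k. a (Suc k) \<le> (1 - t) * a k + t * C"
    and t: "0 < t" "t \<le> 1"
    and r: "strict_mono r" and lim: "(\<lambda>i. a (r i)) \<longlonglongrightarrow> L"
  shows "L \<le> C"
proof -
  have geom: "a k \<le> C + (1 - t) ^ k * (a 0 - C)" for k
  proof (induction k)
    case (Suc k)
    have "(1 - t) * a k \<le> (1 - t) * (C + (1 - t) ^ k * (a 0 - C))"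
      using Suc t by (intro mult_left_mono) auto
    then show ?case using rec[of k] by (simp add: algebra_simps)
  qed simp
  have "(\<lambda>k. C + (1 - t) ^ k * (a 0 - C)) \<longlonglongrightarrow> C + 0 * (a 0 - C)"
    by (intro tendsto_intros) (use t in simp)
  from LIMSEQ_subseq_LIMSEQ[OF this r]
  have "(\<lambda>i. C + (1 - t) ^ r i * (a 0 - C)) \<longlonglongrightarrow> C" by (simp add: o_def)
  then show "L \<le> C"
    by (rule LIMSEQ_le[OF lim]) (use geom in blast)
qed

theorem theorem2:
  fixes \<Phi> :: "real^'n \<Rightarrow> real^'m" and \<Lambda> :: "real^'m"
    and g :: "real^'n \<Rightarrow> ereal" and s :: "nat \<Rightarrow> real^'n"
    and c0 c1 lam rho \<mu> \<alpha> \<beta> \<gamma> :: real and K :: "(real^'n) set"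
  assumes c: "0 < c0" "c0 < c1"
    and K: "K = cbox (vec c0) (vec c1)"
    and diff: "\<And>x. \<Phi> differentiable (at x)"
    and params: "0 < lam" "0 < rho" "0 < \<mu>"
    and g_nonneg: "\<And>x. 0 \<le> g x"
    and g_proper: "edom g \<noteq> {}"
    and g_coercive: "coercive g"
    and g_cont: "continuous_on (edom g) g"
    and g_convex: "econvex g"
    and g_dom: "edom g \<subseteq> K"
    and alpha_beta: "0 < \<alpha>" "\<alpha> \<le> \<beta>"
    and RIP: "\<And>x x1 x2. x \<in> K \<Longrightarrow>
        \<alpha> * (norm (x1 - x2))\<^sup>2 \<le> (norm (Jac \<Phi> x *v (x1 - x2)))\<^sup>2 \<and>
        (norm (Jac \<Phi> x *v (x1 - x2)))\<^sup>2 \<le> \<beta> * (norm (x1 - x2))\<^sup>2"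
    and gamma: "0 < \<gamma>"
    and mild: "\<And>x1 x2. x1 \<in> K \<Longrightarrow> x2 \<in> K \<Longrightarrow>
        (norm (\<Phi> x1 - \<Phi> x2 - Jac \<Phi> x2 *v (x1 - x2)))\<^sup>2 \<le> \<gamma> * (norm (x1 - x2))\<^sup>2"
    and step: "\<mu> \<le> 1 / (2 * \<beta>)" "\<mu> \<le> 1 / (2 * lam * rho)"
    and gap: "0 < \<alpha> + lam * rho - 2 * \<gamma>"
    and iter: "\<And>k. s (Suc k) \<in> prox (\<lambda>x. ereal (\<mu> * lam) * g x)
        (s k - (\<mu> * lam * rho) *\<^sub>R s k + \<mu> *\<^sub>R (transpose (Jac \<Phi> (s k)) *v (\<Lambda> - \<Phi> (s k))))"
  shows "(\<exists>l. cluster_point s l) \<and>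
    (\<forall>l. cluster_point s l \<longrightarrow>
      (\<forall>x\<in>edom g. ereal ((norm (x - l))\<^sup>2)
         \<le> ereal (4 / (\<alpha> + lam * rho - 2 * \<gamma>)) * objective \<Phi> \<Lambda> lam rho g x))"
proof -
  define \<kappa> where "\<kappa> = \<alpha> + lam * rho - 2 * \<gamma>"
  define h where "h = (\<lambda>x. ereal (\<mu> * lam) * g x)"
  have \<kappa>: "0 < \<kappa>" using gap by (simp add: \<kappa>_def)
  have h_nonneg: "0 \<le> h x" for x
    using params g_nonneg by (simp add: h_def)
  have h_convex: "econvex h"
    unfolding h_def using params by (intro econvex_cmult g_convex g_nonneg) simp
  have edom_h: "edom h = edom g"
  proof -
    have "h x < \<infinity> \<longleftrightarrow> g x < \<infinity>" for x
      using params g_nonneg[of x] by (cases "g x") (auto simp: h_def)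
    then show ?thesis by (simp add: edom_def)
  qed
  have step': "\<mu> * (\<beta> + lam * rho) \<le> 1"
  proof -
    have "\<mu> * \<beta> \<le> 1/2" "\<mu> * (lam * rho) \<le> 1/2"
      using step params alpha_beta by (simp_all add: field_simps)
    then show ?thesis by (simp add: algebra_simps)
  qed
  have rate: "\<mu> * \<kappa> \<le> 1"
  proof -
    have "\<mu> * \<kappa> \<le> \<mu> * (\<beta> + lam * rho)"
      using params alpha_beta gamma by (intro mult_left_mono) (auto simp: \<kappa>_def)
    then show ?thesis using step' by simp
  qed
  \<comment> \<open>\<open>s 0\<close> may lie outside \<open>K\<close>, where nothing is known about the Jacobian, so all estimates begin
     at \<open>s 1\<close>.\<close>
  have in_K: "s (Suc k) \<in> K" for k
  proof -
    have "s (Suc k) \<in> edom h"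
      by (rule prox_in_edom[OF iter[folded h_def]]) (simp add: edom_h g_proper)
    then show ?thesis using edom_h g_dom by blast
  qed
  have "\<exists>l. cluster_point s l"
  proof -
    have "compact K" by (simp add: K compact_cbox)
    then obtain l r where r: "strict_mono r" "((\<lambda>k. s (Suc k)) \<circ> r) \<longlonglongrightarrow> l"
      using in_K unfolding compact_def by metis
    have "strict_mono (Suc \<circ> r)" "(s \<circ> (Suc \<circ> r)) \<longlonglongrightarrow> l"
      using r by (auto simp: strict_mono_def o_def)
    then show ?thesis unfolding cluster_point_def by blast
  qed
  moreover have "ereal ((norm (x - l))\<^sup>2)
      \<le> ereal (4 / (\<alpha> + lam * rho - 2 * \<gamma>)) * objective \<Phi> \<Lambda> lam rho g x"
    if l: "cluster_point s l" and x: "x \<in> edom g" for l x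
  proof -
    obtain G where G: "g x = ereal G" "0 \<le> G"
      using x g_nonneg[of x] by (cases "g x") (auto simp: edom_def)
    define Jx where "Jx = smooth_part \<Phi> \<Lambda> lam rho x + lam * G"
    define a where "a = (\<lambda>k. (norm (x - s (Suc k)))\<^sup>2)"
    have rec: "a (Suc k) \<le> (1 - \<mu> * \<kappa>) * a k + \<mu> * \<kappa> * (4 / \<kappa> * Jx)" for k
    proof -
      let ?u = "s (Suc k)" and ?p = "s (Suc (Suc k))"
      let ?A = "Jac \<Phi> ?u" and ?y = "\<Lambda> - \<Phi> (s (Suc k))"
      let ?e = "\<Phi> x - \<Phi> ?u - ?A *v (x - ?u)"
      have xK: "x \<in> K" using x g_dom by blast
      have "(norm (x - ?p))\<^sup>2 \<le> (1 - \<mu> * (lam * rho)) * (norm (x - ?u))\<^sup>2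
          - \<mu> * (norm (?A *v (x - ?u)))\<^sup>2 + \<mu> * (norm (?A *v (x - ?u) - ?y))\<^sup>2
          + \<mu> * (lam * rho) * (norm x)\<^sup>2 + 2 * (\<mu> * lam * G)"
      proof (rule prox_gradient_step_estimate)
        show "?p \<in> prox h (?u - (\<mu> * (lam * rho)) *\<^sub>R ?u + \<mu> *\<^sub>R (transpose ?A *v ?y))"
          using iter[of "Suc k", folded h_def] by (simp add: mult.assoc)
      qed (use h_nonneg h_convex G params step' RIP[OF in_K] in \<open>auto simp: h_def\<close>)
      moreover have "\<mu> * (\<alpha> * (norm (x - ?u))\<^sup>2) \<le> \<mu> * (norm (?A *v (x - ?u)))\<^sup>2"
        using RIP[OF in_K, of x ?u] params by (intro mult_left_mono) auto
      moreover have "\<mu> * (norm (?A *v (x - ?u) - ?y))\<^sup>2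
          \<le> \<mu> * (2 * (norm (\<Phi> x - \<Lambda>))\<^sup>2 + 2 * (\<gamma> * (norm (x - ?u))\<^sup>2))"
      proof (rule mult_left_mono)
        have eq: "?A *v (x - ?u) - ?y = (\<Phi> x - \<Lambda>) - ?e" by simp
        have "(norm (?A *v (x - ?u) - ?y))\<^sup>2 \<le> 2 * (norm (\<Phi> x - \<Lambda>))\<^sup>2 + 2 * (norm ?e)\<^sup>2"
          unfolding eq by (rule norm_diff_power2_le)
        then show "(norm (?A *v (x - ?u) - ?y))\<^sup>2
            \<le> 2 * (norm (\<Phi> x - \<Lambda>))\<^sup>2 + 2 * (\<gamma> * (norm (x - ?u))\<^sup>2)"
          using mild[OF xK in_K, of k] by linarith
      qed (use params in simp)
      \<comment> \<open>The estimates above produce the objective with weight 4 on the misfit, but only 2 on the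
         other two terms, which are nonnegative.\<close>
      moreover have "0 \<le> \<mu> * (lam * rho) * (norm x)\<^sup>2" "0 \<le> \<mu> * lam * G"
        using params G by auto
      ultimately have "(norm (x - ?p))\<^sup>2 \<le> (1 - \<mu> * \<kappa>) * (norm (x - ?u))\<^sup>2 + 4 * \<mu> * Jx"
        by (simp add: Jx_def smooth_part_def \<kappa>_def algebra_simps)
      then show ?thesis using \<kappa> by (simp add: a_def)
    qed
    obtain r where r: "strict_mono r" "(s \<circ> r) \<longlonglongrightarrow> l"
      using l unfolding cluster_point_def by blast
    \<comment> \<open>\<open>a\<close> is shifted by one against \<open>s\<close>, so the subsequence is read off one step later, where
       \<open>r (Suc i) \<ge> 1\<close>.\<close>
    define q where "q = (\<lambda>i. r (Suc i) - 1)"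
    have q: "Suc (q i) = r (Suc i)" for i
      using strict_mono_imp_increasing[OF r(1), of "Suc i"] by (simp add: q_def)
    have "strict_mono q"
      unfolding strict_mono_Suc_iff
    proof
      fix i
      show "q i < q (Suc i)"
        using q[of i] q[of "Suc i"] strict_monoD[OF r(1), of "Suc i" "Suc (Suc i)"] by simp
    qed
    moreover have "(\<lambda>i. a (q i)) \<longlonglongrightarrow> (norm (x - l))\<^sup>2"
      unfolding a_def q using LIMSEQ_Suc[OF r(2)] by (intro tendsto_intros) (simp add: o_def)
    moreover have "0 < \<mu> * \<kappa>" using params \<kappa> by simp
    ultimately have "(norm (x - l))\<^sup>2 \<le> 4 / \<kappa> * Jx"
      using subseq_limit_le_of_affine_recursion[where a = a, OF rec] rate by blast
    then show ?thesis
      by (simp add: objective_def G Jx_def \<kappa>_def)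
  qed
  ultimately show ?thesis by blast
qed

end
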